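(* For every integer $n\geq 0$, (i) $\displaystyle \sum_{j=-\infty}^\infty p\big(n-3j(3j-1)\big) \equiv Q_2(n) \pmod 2$; (ii) $\displaystyle \sum_{j=0}^\infty p\big(n-j(j+1)\big) \equiv Q_2(n) \pmod 3$.
   Context: $p(n)$ denotes the number of partitions of $n$, with $p(0)=1$ and $p(n)=0$ for $n<0$. $Q_2(n)$ denotes the number of partitions of $n$ into distinct parts which are not congruent to $\pm 2$ modulo $6$ (with $Q_2(0)=1$). *)

theory Defs
  imports Main "HOL-Library.Multiset" "HOL-Library.Groups_Big_Fun" "HOL-Number_Theory.Cong"
begin

text \<open>A partition is the multiset of its parts, which are positive integers.  The total is an
  integer, so that there are no partitions of a negative number.\<close>

definition partitions :: "int \<Rightarrow> nat multiset set" where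
  "partitions n = {M. 0 \<notin># M \<and> int (sum_mset M) = n}"

definition p :: "int \<Rightarrow> nat" where
  "p n = card (partitions n)"

definition Q2 :: "nat \<Rightarrow> nat" where
  "Q2 n = card {M \<in> partitions (int n).
     \<forall>k \<in># M. count M k = 1 \<and> \<not> [int k = 2] (mod 6) \<and> \<not> [int k = -2] (mod 6)}"

text \<open>\<^const>\<open>card\<close> is 0 on infinite sets and \<^const>\<open>Sum_any\<close> is 0 on functions with
  infinite support; the following facts show that neither convention comes into play.\<close>

lemma size_le_sum_mset: "0 \<notin># M \<Longrightarrow> size M \<le> sum_mset M" for M :: "nat multiset"
  by (induction M) auto

lemma partitionsD:
  assumes "M \<in> partitions n"
  shows "0 \<notin># M" "0 \<le> n" "sum_mset M = nat n"
proof -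
  have *: "0 \<notin># M \<and> int (sum_mset M) = n"
    using assms unfolding partitions_def by (rule CollectD)
  then show "0 \<notin># M" by (rule conjunct1)
  from * have n: "n = int (sum_mset M)" by blast
  show "0 \<le> n" unfolding n by (rule of_nat_0_le_iff)
  show "sum_mset M = nat n" unfolding n by (rule nat_int[symmetric])
qed

lemma finite_partitions: "finite (partitions n)"
proof (rule finite_subset)
  let ?L = "{xs. set xs \<subseteq> {..nat n} \<and> length xs \<le> nat n}"
  show "finite (mset ` ?L)"
    by (intro finite_imageI finite_lists_length_le) simp
  show "partitions n \<subseteq> mset ` ?L"
  proof
    fix M assume "M \<in> partitions n"
    then have M: "0 \<notin># M" "sum_mset M = nat n"
      by (rule partitionsD)+
    obtain xs where xs: "M = mset xs"
      by (metis ex_mset)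
    have "x \<le> nat n" if "x \<in># M" for x
      using that M(2) by (metis sum_mset.remove le_add1)
    then have "xs \<in> ?L"
      using M size_le_sum_mset[of M] xs by auto
    then show "M \<in> mset ` ?L"
      using xs by blast
  qed
qed

lemma p_neg: "n < 0 \<Longrightarrow> p n = 0"
  using partitionsD(2)[of _ n] by (fastforce simp: p_def card_eq_0_iff)

lemma partitions_0: "partitions 0 = {{#}}"
proof (intro equalityI subsetI)
  fix M assume "M \<in> partitions 0"
  then have "size M \<le> 0"
    using size_le_sum_mset[of M] partitionsD[of M 0] by simp
  then show "M \<in> {{#}}" by simp
qed (simp add: partitions_def)

lemma p_0: "p 0 = 1"
  by (simp add: p_def partitions_0)

lemma Q2_0: "Q2 0 = 1"
proof -
  have "{M \<in> partitions (int 0).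
     \<forall>k \<in># M. count M k = 1 \<and> \<not> [int k = 2] (mod 6) \<and> \<not> [int k = -2] (mod 6)} = {{#}}"
    by (simp only: of_nat_0 partitions_0) auto
  then show ?thesis
    by (simp only: Q2_def) simp
qed

lemma finite_support_i: "finite {j. p (int n - 3 * j * (3 * j - 1)) \<noteq> 0}"
proof (rule finite_subset)
  have "\<bar>j\<bar> \<le> int n" if "p (int n - 3 * j * (3 * j - 1)) \<noteq> 0" for j
  proof -
    have "3 * j * (3 * j - 1) \<le> int n"
      using that p_neg[of "int n - 3 * j * (3 * j - 1)"] by (cases "3 * j * (3 * j - 1) \<le> int n") auto
    moreover have "\<bar>j\<bar> \<le> 3 * j * (3 * j - 1)"
    proof (cases "j \<ge> 1")
      case True
      then have "j * 1 \<le> j * (3 * (3 * j - 1))"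
        by (intro mult_left_mono) auto
      with True show ?thesis by (simp add: algebra_simps)
    next
      case False
      then have "(-j) * 1 \<le> (-j) * (3 * (1 - 3 * j))"
        by (intro mult_left_mono) auto
      with False show ?thesis by (simp add: algebra_simps)
    qed
    ultimately show ?thesis by linarith
  qed
  then show "{j. p (int n - 3 * j * (3 * j - 1)) \<noteq> 0} \<subseteq> {- int n..int n}"
    by (fastforce simp: abs_le_iff)
qed simp

lemma finite_support_ii: "finite {j :: nat. p (int n - int j * (int j + 1)) \<noteq> 0}"
proof (rule finite_subset)
  have "j \<le> n" if "p (int n - int j * (int j + 1)) \<noteq> 0" for j
  proof -
    have "int j * (int j + 1) \<le> int n"
      using that p_neg[of "int n - int j * (int j + 1)"] by (cases "int j * (int j + 1) \<le> int n") auto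
    moreover have "int j * 1 \<le> int j * (int j + 1)"
      by (intro mult_left_mono) auto
    ultimately show ?thesis by linarith
  qed
  then show "{j :: nat. p (int n - int j * (int j + 1)) \<noteq> 0} \<subseteq> {..n}"
    by auto
qed simp

end

theory Submission
  imports Defs "HOL-Library.Numeral_Type" "HOL-Computational_Algebra.Formal_Power_Series"
begin

text \<open>With $E(q) = \prod_{k \ge 1} (1 - q^k)$, the generating function of $p$ is $1/E(q)$ and that of
  $Q_2$ is $\prod_k (1 + q^{2k-1})(1 + q^{6k})$.

  Modulo 2, Euler's pentagonal number theorem gives $\sum_j q^{3j(3j-1)} = E(q^6) =
  \prod_k (1 + q^{6k})$, and $E(q^2) = E(q)^2$ gives $\prod_k (1 + q^{2k-1}) = 1/E(q)$.

  Modulo 3, $\prod_k (1 + q^{6k}) = \prod_k (1 + q^{2k})^3$, which turns the generating function of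
  $Q_2$ into $E(q^4)^2 / (E(q) E(q^2))$; by Gauss's identity $\sum_j q^{j(j+1)} = E(q^4)^2 / E(q^2)$.

  The identities of Euler and Gauss are limits of finite identities due to Shanks, both proved by
  telescoping and both valid over any commutative ring, so infinite products can be avoided: for a
  given $n$ it suffices to compare coefficients up to degree $n$.\<close>

section \<open>Two finite identities of Shanks\<close>

text \<open>The factor \<open>(1 - x^Suc n) * x^s - 1\<close> is the relative change of the s-th
  summand in the pentagonal sum when n grows by one, so this evaluates the increment in the
  induction for \<open>Shanks_pentagonal\<close>.\<close>

lemma Shanks_telescope:
  fixes x :: "'a::comm_ring_1"
  shows "(\<Sum>s=0..n. (-1)^s * (\<Prod>k=Suc s..n. 1 - x^k) * x^(s*n + (\<Sum>{..s})) * ((1 - x^Suc n) * x^s - 1))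
       = (-1)^Suc n * x^(Suc n * n + (\<Sum>{..Suc n}))"
proof -
  \<comment> \<open>Starting the product at k = s turns each summand into a difference of values of
    \<open>V\<close>. For s = 0 it contains the factor 1 - x^0, so \<open>V 0\<close>
    vanishes.\<close>
  define V where "V s = (-1)^s * (\<Prod>k=s..n. 1 - x^k) * x^(s*n + (\<Sum>{..s}))" for s
  have "(-1)^s * (\<Prod>k=Suc s..n. 1 - x^k) * x^(s*n + (\<Sum>{..s})) * ((1 - x^Suc n) * x^s - 1)
      = V (Suc s) - V s" if "s \<le> n" for s
  proof -
    have R: "(\<Prod>k=s..n. 1 - x^k) = (1 - x^s) * (\<Prod>k=Suc s..n. 1 - x^k)"
      using that by (rule prod.atLeast_Suc_atMost)
    have "x^(Suc s * n + (\<Sum>{..Suc s})) = x^(s*n + (\<Sum>{..s})) * x^Suc n * x^s"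
      by (simp add: power_add algebra_simps)
    then show ?thesis
      unfolding V_def R by (simp add: algebra_simps)
  qed
  then have "(\<Sum>s=0..n. (-1)^s * (\<Prod>k=Suc s..n. 1 - x^k) * x^(s*n + (\<Sum>{..s})) * ((1 - x^Suc n) * x^s - 1))
      = (\<Sum>s=0..n. V (Suc s) - V s)"
    by (intro sum.cong) auto
  also have "\<dots> = V (Suc n) - V 0"
    by (rule sum_Suc_diff) simp
  also have "V 0 = 0"
    unfolding V_def by (simp add: prod.atLeast_Suc_atMost[of 0 n])
  finally show ?thesis by (simp add: V_def)
qed

text \<open>The exponents avoid division: $\sum_{i \le m} i = m(m+1)/2$, so those on the right-hand side
  are the pentagonal numbers $m(3m \mp 1)/2$.\<close>

lemma Shanks_pentagonal:
  fixes x :: "'a::comm_ring_1"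
  shows "(\<Sum>s=0..n. (-1)^s * (\<Prod>k=Suc s..n. 1 - x^k) * x^(s*n + (\<Sum>{..s})))
       = 1 + (\<Sum>m=1..n. (-1)^m * (x^(m*(m-1) + (\<Sum>{..m})) + x^(m*m + (\<Sum>{..m}))))"
proof (induction n)
  case 0
  show ?case by simp
next
  case (Suc n)
  define t where "t s = (-1)^s * (\<Prod>k=Suc s..n. 1 - x^k) * x^(s*n + (\<Sum>{..s}))" for s
  have "(-1)^s * (\<Prod>k=Suc s..Suc n. 1 - x^k) * x^(s*Suc n + (\<Sum>{..s}))
       = t s + t s * ((1 - x^Suc n) * x^s - 1)" if "s \<le> n" for s
    using that by (simp add: t_def power_add algebra_simps)
  then have "(\<Sum>s=0..n. (-1)^s * (\<Prod>k=Suc s..Suc n. 1 - x^k) * x^(s*Suc n + (\<Sum>{..s})))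
      = (\<Sum>s=0..n. t s) + (\<Sum>s=0..n. t s * ((1 - x^Suc n) * x^s - 1))"
    unfolding sum.distrib[symmetric] by (intro sum.cong) auto
  also have "(\<Sum>s=0..n. t s * ((1 - x^Suc n) * x^s - 1)) = (-1)^Suc n * x^(Suc n * n + (\<Sum>{..Suc n}))"
    unfolding t_def by (rule Shanks_telescope)
  \<comment> \<open>For m = n + 1, the telescoped remainder has the exponent m(m-1) + m(m+1)/2, and
    the still missing summand s = n + 1 has m^2 + m(m+1)/2.\<close>
  finally show ?case
    using Suc.IH unfolding t_def
    by (simp add: algebra_simps)
qed

text \<open>Induction on n: each new summand is 1 - x^(2n+1), the new factor on the right, times the
  old one, up to a telescoping difference. The boundary terms supply two further triangular
  exponents.\<close>

lemma Shanks_triangular: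
  fixes x :: "'a::comm_ring_1"
  shows "(\<Sum>s<n. (\<Prod>k=Suc s..n. 1 - x^(2*k)) * (\<Prod>k=1..s. 1 - x^(2*k-1)) * x^(s*(2*n+1)))
       = (\<Prod>k=1..n. 1 - x^(2*k-1)) * (\<Sum>j<2*n. x^(\<Sum>{..j}))"
proof (induction n)
  case 0
  show ?case by simp
next
  case (Suc n)
  define R where "R a = (\<Prod>k=a..n. 1 - x^(2*k))" for a
  define O1 where "O1 s = (\<Prod>k=1..s. 1 - x^(2*k-1))" for s
  define T where "T = (\<Sum>j<2*n. x^(\<Sum>{..j}))"
  \<comment> \<open>As before, the product includes k = s, which makes \<open>V 0\<close>
    vanish.\<close>
  define V where "V s = R s * O1 s * x^(s*(2*n+1))" for s
  have O1_Suc: "O1 (Suc s) = O1 s * (1 - x^(2*s+1))" for s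
    by (simp add: O1_def)
  have step: "(1 - x^(2*n+2)) * R (Suc s) * O1 s * x^(s*(2*n+3))
      = (1 - x^(2*n+1)) * (R (Suc s) * O1 s * x^(s*(2*n+1))) + (V (Suc s) - V s)" if "s < n" for s
  proof -
    have R: "R s = (1 - x^(2*s)) * R (Suc s)"
      unfolding R_def using that by (intro prod.atLeast_Suc_atMost) simp
    have "x^(s*(2*n+3)) = x^(s*(2*n+1)) * x^(2*s)"
      by (simp add: algebra_simps flip: power_add)
    moreover have "x^(Suc s*(2*n+1)) = x^(s*(2*n+1)) * x^(2*n+1)"
      by (simp add: algebra_simps flip: power_add)
    moreover have "x^(2*n+2) = x^(2*n+1) * x"
      by simp
    moreover have "x^(2*s+1) = x^(2*s) * x"
      by simp
    ultimately show ?thesis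
      unfolding V_def R O1_Suc by (simp add: algebra_simps del: mult_Suc)
  qed
  have Suc3: "2 * Suc n + 1 = 2 * n + 3"
    by simp
  have R_Suc: "(\<Prod>k=Suc s..Suc n. 1 - x^(2*k)) = (1 - x^(2*n+2)) * R (Suc s)" if "s \<le> n" for s
    using that by (simp add: R_def mult.commute)
  have "(\<Sum>s<Suc n. (\<Prod>k=Suc s..Suc n. 1 - x^(2*k)) * (\<Prod>k=1..s. 1 - x^(2*k-1)) * x^(s*(2*Suc n+1)))
     = (\<Sum>s<Suc n. (1 - x^(2*n+2)) * R (Suc s) * O1 s * x^(s*(2*n+3)))"
    by (intro sum.cong) (simp_all only: lessThan_iff less_Suc_eq_le R_Suc O1_def Suc3)
  also have "\<dots> = (\<Sum>s<n. (1 - x^(2*n+1)) * (R (Suc s) * O1 s * x^(s*(2*n+1))) + (V (Suc s) - V s))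
       + (1 - x^(2*n+2)) * O1 n * x^(n*(2*n+3))"
    unfolding sum.lessThan_Suc using step by (simp add: R_def)
  also have "\<dots> = (1 - x^(2*n+1)) * (O1 n * T) + (V n - V 0) + (1 - x^(2*n+2)) * O1 n * x^(n*(2*n+3))"
    using Suc.IH by (simp add: sum.distrib sum_lessThan_telescope R_def O1_def T_def flip: sum_distrib_left)
  also have "V 0 = 0"
    unfolding V_def R_def by (simp add: prod.atLeast_Suc_atMost[of 0 n])
  also have "V n = (1 - x^(2*n)) * O1 n * x^(n*(2*n+1))"
    by (simp add: V_def R_def)
  also have "(1 - x^(2*n+1)) * (O1 n * T) + ((1 - x^(2*n)) * O1 n * x^(n*(2*n+1)) - 0)
        + (1 - x^(2*n+2)) * O1 n * x^(n*(2*n+3))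
      = O1 (Suc n) * (T + x^(n*(2*n+1)) + x^((n+1)*(2*n+1)))"
  proof -
    have "x^(n*(2*n+3)) = x^(n*(2*n+1)) * x^(2*n)"
      by (simp add: algebra_simps flip: power_add)
    moreover have "x^((n+1)*(2*n+1)) = x^(n*(2*n+1)) * (x^(2*n) * x)"
      by (simp add: algebra_simps flip: power_add)
    ultimately show ?thesis
      unfolding O1_Suc by (simp add: algebra_simps)
  qed
  \<comment> \<open>The two new exponents are the triangular numbers of index 2n and 2n + 1.\<close>
  also have "T + x^(n*(2*n+1)) + x^((n+1)*(2*n+1)) = (\<Sum>j<2*Suc n. x^(\<Sum>{..j}))"
  proof -
    have "n*(2*n+1) = \<Sum>{..2*n}"
      by (simp add: atLeast0AtMost[symmetric] gauss_sum_nat)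
    moreover have "(n+1)*(2*n+1) = \<Sum>{..Suc (2*n)}"
      using calculation by simp
    moreover have "2 * Suc n = Suc (Suc (2*n))"
      by simp
    ultimately show ?thesis
      by (simp only: T_def sum.lessThan_Suc)
  qed
  finally show ?case
    by (simp add: O1_def)
qed

section \<open>Agreement of power series up to a given degree\<close>

text \<open>This is congruence modulo X^(n+1), hence compatible with sums and products.\<close>

definition eq_upto :: "nat \<Rightarrow> 'a::comm_ring_1 fps \<Rightarrow> 'a fps \<Rightarrow> bool" where
  "eq_upto n f g \<longleftrightarrow> (\<forall>k\<le>n. fps_nth f k = fps_nth g k)"

lemma eq_upto_refl [simp]: "eq_upto n f f"
  by (simp add: eq_upto_def)

lemma eq_upto_sym: "eq_upto n f g \<Longrightarrow> eq_upto n g f"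
  by (simp add: eq_upto_def)

lemma eq_upto_trans [trans]: "eq_upto n f g \<Longrightarrow> eq_upto n g h \<Longrightarrow> eq_upto n f h"
  by (simp add: eq_upto_def)

lemma eq_upto_add: "eq_upto n f g \<Longrightarrow> eq_upto n f' g' \<Longrightarrow> eq_upto n (f + f') (g + g')"
  by (simp add: eq_upto_def)

lemma eq_upto_mult: "eq_upto n f g \<Longrightarrow> eq_upto n f' g' \<Longrightarrow> eq_upto n (f * f') (g * g')"
  by (auto simp: eq_upto_def fps_mult_nth intro!: sum.cong)

lemma eq_upto_fps_X_power_mult: "n < m \<Longrightarrow> eq_upto n (f * fps_X^m) 0"
  by (simp add: eq_upto_def fps_X_power_mult_right_nth)

lemma eq_upto_one_minus: "n < m \<Longrightarrow> eq_upto n (1 - fps_X^m) 1"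
  by (simp add: eq_upto_def fps_X_power_nth)

lemma eq_upto_one_plus: "n < m \<Longrightarrow> eq_upto n (1 + fps_X^m) 1"
  by (simp add: eq_upto_def fps_X_power_nth)

lemma eq_upto_sum_0: "(\<And>i. i \<in> A \<Longrightarrow> eq_upto n (f i) 0) \<Longrightarrow> eq_upto n (sum f A) 0"
  by (simp add: eq_upto_def fps_sum_nth)

lemma eq_upto_prod_neutral:
  assumes "finite B" "A \<subseteq> B" "\<And>k. k \<in> B - A \<Longrightarrow> eq_upto n (f k) 1"
  shows "eq_upto n (prod f B) (prod f A)"
proof -
  have "eq_upto n (prod f C) 1" if "C \<subseteq> B - A" for C
    using finite_subset[OF that finite_Diff[OF assms(1)]] that
  proof (induction rule: finite_induct)
    case (insert k C)
    then show ?case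
      using eq_upto_mult[OF assms(3)[of k] insert.IH] by simp
  qed simp
  then have "eq_upto n (prod f (B - A) * prod f A) (1 * prod f A)"
    by (intro eq_upto_mult) auto
  then show ?thesis
    by (simp add: prod.subset_diff[OF assms(2,1), of f])
qed

text \<open>A series with constant coefficient 1 is a unit over any commutative ring; this replaces
  division by Euler products.\<close>

lemma eq_upto_cancel:
  assumes "eq_upto n (u * f) (u * g)" "fps_nth u 0 = 1"
  shows "eq_upto n f g"
proof -
  have u: "fps_right_inverse u 1 * u = 1"
    using fps_right_inverse[of u 1] assms(2) by (simp add: mult.commute)
  have "eq_upto n (fps_right_inverse u 1 * (u * f)) (fps_right_inverse u 1 * (u * g))"
    by (intro eq_upto_mult assms(1)) simp
  then show ?thesis
    by (simp add: u flip: mult.assoc)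
qed

lemma fps_nth_0_prod: "fps_nth (prod f A) 0 = (\<Prod>i\<in>A. fps_nth (f i) 0)"
  by (induction A rule: infinite_finite_induct) (simp_all only: prod.infinite prod.empty prod.insert fps_mult_nth_0 fps_one_nth, simp_all)

section \<open>Truncated Euler products\<close>

text \<open>Truncation of E(q^d). Here n counts factors and does not bound exponents, so that
  \<open>qminus_mult_qplus\<close> is an exact identity; for d > 0 the omitted factors are 1 up to
  degree n.\<close>

definition qminus :: "nat \<Rightarrow> nat \<Rightarrow> 'a::comm_ring_1 fps" where
  "qminus n d = (\<Prod>k=1..n. 1 - fps_X^(d*k))"

definition qplus :: "nat \<Rightarrow> nat \<Rightarrow> 'a::comm_ring_1 fps" where
  "qplus n d = (\<Prod>k=1..n. 1 + fps_X^(d*k))"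

definition qminus_odd :: "nat \<Rightarrow> nat \<Rightarrow> 'a::comm_ring_1 fps" where
  "qminus_odd n d = (\<Prod>k=1..n. 1 - fps_X^(d*(2*k-1)))"

definition qplus_odd :: "nat \<Rightarrow> nat \<Rightarrow> 'a::comm_ring_1 fps" where
  "qplus_odd n d = (\<Prod>k=1..n. 1 + fps_X^(d*(2*k-1)))"

lemma qminus_nth_0: "d > 0 \<Longrightarrow> fps_nth (qminus n d) 0 = 1"
  by (simp add: qminus_def fps_nth_0_prod fps_X_power_nth)

lemma qplus_nth_0: "d > 0 \<Longrightarrow> fps_nth (qplus n d) 0 = 1"
  by (simp add: qplus_def fps_nth_0_prod fps_X_power_nth)

lemma qminus_mult_qplus: "qminus n d * qplus n d = qminus n (2*d)"
proof -
  have "(1 - fps_X^(d*k)) * (1 + fps_X^(d*k)) = (1 - fps_X^(2*d*k) :: 'a fps)" for k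
    by (simp add: algebra_simps power_mult power2_eq_square flip: power_add)
  then show ?thesis
    by (simp add: qminus_def qplus_def prod.distrib[symmetric])
qed

lemma prod_split_parity:
  fixes f :: "nat \<Rightarrow> 'a::comm_monoid_mult"
  shows "(\<Prod>k=1..2*n. f k) = (\<Prod>k=1..n. f (2*k-1)) * (\<Prod>k=1..n. f (2*k))"
proof (induction n)
  case (Suc n)
  have "(\<Prod>k=1..2 * Suc n. f k) = (\<Prod>k=1..2 * n. f k) * f (2 * n + 1) * f (2 * n + 2)"
    by simp
  then show ?case
    using Suc.IH by (simp add: mult_ac)
qed simp

text \<open>Sorting 2n factors by parity gives n of each kind. The surplus factors n < k \<le> 2n
  are 1 up to degree n.\<close>

lemma qminus_split:
  assumes "d > 0"
  shows "eq_upto n (qminus n d) (qminus_odd n d * qminus n (2*d))"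
proof -
  have "n < d * k" if "n < k" for k
    using that assms by (auto intro: less_le_trans[of n k "d * k"])
  then have "eq_upto n (\<Prod>k=1..2*n. 1 - fps_X^(d*k)) (\<Prod>k=1..n. 1 - fps_X^(d*k))"
    by (intro eq_upto_prod_neutral eq_upto_one_minus) auto
  from eq_upto_sym[OF this] show ?thesis
    unfolding prod_split_parity qminus_def qminus_odd_def
    by (simp add: mult_ac)
qed

lemma qplus_split:
  assumes "d > 0"
  shows "eq_upto n (qplus n d) (qplus_odd n d * qplus n (2*d))"
proof -
  have "n < d * k" if "n < k" for k
    using that assms by (auto intro: less_le_trans[of n k "d * k"])
  then have "eq_upto n (\<Prod>k=1..2*n. 1 + fps_X^(d*k)) (\<Prod>k=1..n. 1 + fps_X^(d*k))"
    by (intro eq_upto_prod_neutral eq_upto_one_plus) auto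
  from eq_upto_sym[OF this] show ?thesis
    unfolding prod_split_parity qplus_def qplus_odd_def
    by (simp add: mult_ac)
qed

text \<open>Euler's theorem on odd and distinct parts, in product form. Multiplied by E(q^(2d)), the
  left side becomes E(q^d) times \<open>qplus n d\<close>, which is E(q^(2d)) again.\<close>

lemma Euler_odd_distinct:
  assumes "d > 0"
  shows "eq_upto n (qminus_odd n d * qplus n d) 1"
proof (rule eq_upto_cancel)
  have "eq_upto n (qminus_odd n d * qminus n (2*d) * qplus n d) (qminus n d * qplus n d)"
    by (intro eq_upto_mult eq_upto_sym[OF qminus_split] assms) simp
  then show "eq_upto n (qminus n (2*d) * (qminus_odd n d * qplus n d)) (qminus n (2*d) * (1 :: 'a fps))"
    by (simp add: qminus_mult_qplus ac_simps)
qed (use assms in \<open>simp add: qminus_nth_0\<close>)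

text \<open>In Shanks's sum at x = q^d the summand s = 0 is the Euler product, and every other one
  is divisible by a power of q above n.\<close>

lemma pentagonal_upto:
  assumes "d > 0"
  shows "eq_upto n (qminus n d)
    (1 + (\<Sum>m=1..n. (-1)^m * (fps_X^(d*(m*(m-1) + (\<Sum>{..m}))) + fps_X^(d*(m*m + (\<Sum>{..m}))))) :: 'a::comm_ring_1 fps)"
proof -
  define t :: "nat \<Rightarrow> 'a fps" where
    "t s = (-1)^s * (\<Prod>k=Suc s..n. 1 - fps_X^(d*k)) * fps_X^(d*(s*n + (\<Sum>{..s})))" for s
  have "eq_upto n (t s) 0" if "s \<in> {1..n}" for s
  proof -
    have "1 * n + 1 \<le> s * n + (\<Sum>{..s})"
      using that by (intro add_mono mult_right_mono) (auto intro: le_trans[OF _ member_le_sum[of s]])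
    moreover have "1 * (s * n + (\<Sum>{..s})) \<le> d * (s*n + (\<Sum>{..s}))"
      using assms by (intro mult_le_mono1) simp
    ultimately have "n < d * (s*n + (\<Sum>{..s}))"
      by (metis Suc_eq_plus1 Suc_le_eq le_trans mult_1)
    then show ?thesis
      unfolding t_def by (rule eq_upto_fps_X_power_mult)
  qed
  then have "eq_upto n (t 0 + (\<Sum>s=1..n. t s)) (t 0 + 0)"
    by (intro eq_upto_add eq_upto_sum_0) auto
  also have "t 0 + (\<Sum>s=1..n. t s) = (\<Sum>s=0..n. t s)"
    by (simp add: sum.atLeast_Suc_atMost)
  also have "\<dots> = 1 + (\<Sum>m=1..n. (-1)^m * (fps_X^(d*(m*(m-1) + (\<Sum>{..m}))) + fps_X^(d*(m*m + (\<Sum>{..m})))))"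
    using Shanks_pentagonal[where x = "fps_X^d :: 'a fps" and n = n]
    by (simp only: t_def flip: power_mult)
  finally show ?thesis
    by (simp add: t_def qminus_def eq_upto_def)
qed

lemma triangular_upto:
  assumes "d > 0"
  shows "eq_upto n (qminus n (2*d)) (qminus_odd n d * (\<Sum>j\<le>2*n. fps_X^(d*(\<Sum>{..j}))) :: 'a::comm_ring_1 fps)"
\<comment> \<open>For n = 0 Shanks's sum is empty and lacks the summand s = 0 that carries the
  product.\<close>
proof (cases "n = 0")
  case True
  then show ?thesis
    by (simp add: qminus_def qminus_odd_def)
next
  case False
  define t :: "nat \<Rightarrow> 'a fps" where
    "t s = (\<Prod>k=Suc s..n. 1 - fps_X^(d*(2*k))) * (\<Prod>k=1..s. 1 - fps_X^(d*(2*k-1))) * fps_X^(d*(s*(2*n+1)))" for s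
  have "eq_upto n (t s) 0" if "s \<in> {1..<n}" for s
  proof -
    have "1 * (1 * (2*n+1)) \<le> d * (s*(2*n+1))"
      using that assms by (intro mult_le_mono) auto
    then show ?thesis
      unfolding t_def by (intro eq_upto_fps_X_power_mult) simp
  qed
  then have "eq_upto n (t 0 + (\<Sum>s=1..<n. t s)) (t 0 + 0)"
    by (intro eq_upto_add eq_upto_sum_0) auto
  also have "t 0 + (\<Sum>s=1..<n. t s) = (\<Sum>s<n. t s)"
    using False by (simp add: lessThan_atLeast0 sum.atLeast_Suc_lessThan)
  also have "\<dots> = qminus_odd n d * (\<Sum>j<2*n. fps_X^(d*(\<Sum>{..j})))"
    using Shanks_triangular[where x = "fps_X^d :: 'a fps" and n = n]
    by (simp only: t_def qminus_odd_def flip: power_mult)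
  also have "t 0 + 0 = qminus n (2*d)"
    by (simp add: t_def qminus_def mult_ac)
  finally have main: "eq_upto n (qminus_odd n d * (\<Sum>j<2*n. fps_X^(d*(\<Sum>{..j})))) (qminus n (2*d) :: 'a fps)" .
  \<comment> \<open>The triangular number of index 2n is at least 2n > n, so the term j = 2n can be
    added unnoticed.\<close>
  have "1 * (2*n) \<le> d * (\<Sum>{..2*n})"
    using assms by (intro mult_le_mono member_le_sum) auto
  then have "eq_upto n (qminus_odd n d * fps_X^(d*(\<Sum>{..2*n}))) (0 :: 'a fps)"
    using False by (intro eq_upto_fps_X_power_mult) simp
  from eq_upto_add[OF eq_upto_sym[OF main] eq_upto_sym[OF this]] show ?thesis
    by (simp add: distrib_left flip: lessThan_Suc_atMost)
qed

section \<open>Generating functions of partitions\<close>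

definition parts_in :: "nat set \<Rightarrow> nat \<Rightarrow> nat multiset set" where
  "parts_in S k = {M. set_mset M \<subseteq> S \<and> sum_mset M = k}"

definition distinct_parts_in :: "nat set \<Rightarrow> nat \<Rightarrow> nat multiset set" where
  "distinct_parts_in S k = {M \<in> parts_in S k. \<forall>x\<in>#M. count M x = 1}"

lemma finite_parts_in: "0 \<notin> S \<Longrightarrow> finite (parts_in S k)"
  by (rule finite_subset[OF _ finite_partitions[of "int k"]]) (auto simp: parts_in_def partitions_def)

lemma finite_distinct_parts_in: "0 \<notin> S \<Longrightarrow> finite (distinct_parts_in S k)"
  using finite_parts_in by (simp add: distinct_parts_in_def)

text \<open>Either a does not occur, or removing one copy leaves a multiset in which a may occur
  again. This recursion yields the factor 1/(1 - q^a).\<close>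

lemma parts_in_insert:
  "parts_in (insert a S) k =
     parts_in S k \<union> (if a \<le> k then add_mset a ` parts_in (insert a S) (k - a) else {})"
proof (intro equalityI subsetI)
  fix M assume M: "M \<in> parts_in (insert a S) k"
  show "M \<in> parts_in S k \<union> (if a \<le> k then add_mset a ` parts_in (insert a S) (k - a) else {})"
  proof (cases "a \<in># M")
    case True
    then obtain M' where "M = add_mset a M'"
      by (metis mset_add)
    then show ?thesis
      using M by (auto simp: parts_in_def)
  qed (use M in \<open>auto simp: parts_in_def\<close>)
next
  fix M assume "M \<in> parts_in S k \<union> (if a \<le> k then add_mset a ` parts_in (insert a S) (k - a) else {})"
  then show "M \<in> parts_in (insert a S) k"
    by (auto simp: parts_in_def split: if_splits)
qed

text \<open>Here removing a leaves no further copy, so the recursion falls back to \<open>S\<close>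
  and yields the factor 1 + q^a.\<close>

lemma distinct_parts_in_insert:
  assumes "a \<notin> S"
  shows "distinct_parts_in (insert a S) k =
     distinct_parts_in S k \<union> (if a \<le> k then add_mset a ` distinct_parts_in S (k - a) else {})"
proof (intro equalityI subsetI)
  fix M assume M: "M \<in> distinct_parts_in (insert a S) k"
  show "M \<in> distinct_parts_in S k \<union> (if a \<le> k then add_mset a ` distinct_parts_in S (k - a) else {})"
  proof (cases "a \<in># M")
    case True
    then obtain M' where M': "M = add_mset a M'"
      by (metis mset_add)
    have "a \<notin># M'"
      using M M' by (auto simp: distinct_parts_in_def not_in_iff)
    then have "M' \<in> distinct_parts_in S (k - a)"
      using M M' by (fastforce simp: distinct_parts_in_def parts_in_def split: if_splits)
    moreover have "a \<le> k"
      using M M' by (auto simp: distinct_parts_in_def parts_in_def)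
    ultimately show ?thesis
      using M' by auto
  qed (use M in \<open>auto simp: distinct_parts_in_def parts_in_def\<close>)
next
  fix M assume "M \<in> distinct_parts_in S k \<union> (if a \<le> k then add_mset a ` distinct_parts_in S (k - a) else {})"
  then show "M \<in> distinct_parts_in (insert a S) k"
    using assms by (auto simp: distinct_parts_in_def parts_in_def not_in_iff[symmetric] split: if_splits)
qed

definition parts_gf :: "nat set \<Rightarrow> 'a::comm_ring_1 fps" where
  "parts_gf S = Abs_fps (\<lambda>k. of_nat (card (parts_in S k)))"

definition distinct_gf :: "nat set \<Rightarrow> 'a::comm_ring_1 fps" where
  "distinct_gf S = Abs_fps (\<lambda>k. of_nat (card (distinct_parts_in S k)))"

text \<open>Excluding the part 0 keeps the counted sets finite, so that \<open>card\<close> of the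
  disjoint union is additive.\<close>

lemma parts_gf_insert:
  assumes "a \<notin> S" "0 \<notin> insert a S"
  shows "(1 - fps_X^a) * parts_gf (insert a S) = parts_gf S"
proof (rule fps_ext)
  fix k
  have "card (parts_in (insert a S) k) =
     card (parts_in S k) + card (if a \<le> k then add_mset a ` parts_in (insert a S) (k - a) else {})"
  proof (subst parts_in_insert, rule card_Un_disjoint)
    have "a \<notin># M" if "M \<in> parts_in S k" for M
      using that assms(1) by (auto simp: parts_in_def)
    moreover have "a \<in># M" if "M \<in> (if a \<le> k then add_mset a ` parts_in (insert a S) (k - a) else {})" for M
      using that by (auto split: if_splits)
    ultimately show "parts_in S k \<inter> (if a \<le> k then add_mset a ` parts_in (insert a S) (k - a) else {}) = {}"
      by blast
  qed (use assms(2) in \<open>simp_all add: finite_parts_in\<close>)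
  also have "\<dots> = card (parts_in S k) + (if a \<le> k then card (parts_in (insert a S) (k - a)) else 0)"
    by (simp add: card_image inj_on_def)
  finally have rec: "card (parts_in (insert a S) k) = \<dots>" .
  have "fps_nth ((1 - fps_X^a) * parts_gf (insert a S) :: 'a fps) k = of_nat (card (parts_in (insert a S) k))
      - (if a \<le> k then of_nat (card (parts_in (insert a S) (k - a))) else 0)"
    by (simp add: parts_gf_def left_diff_distrib fps_X_power_mult_nth)
  also have "\<dots> = fps_nth (parts_gf S) k"
    by (subst rec) (simp add: parts_gf_def)
  finally show "fps_nth ((1 - fps_X^a) * parts_gf (insert a S) :: 'a fps) k = fps_nth (parts_gf S) k" .
qed

lemma distinct_gf_insert:
  assumes "a \<notin> S" "0 \<notin> insert a S"
  shows "distinct_gf (insert a S) = (1 + fps_X^a) * distinct_gf S"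
proof (rule fps_ext)
  fix k
  have "card (distinct_parts_in (insert a S) k) =
     card (distinct_parts_in S k) + card (if a \<le> k then add_mset a ` distinct_parts_in S (k - a) else {})"
    unfolding distinct_parts_in_insert[OF assms(1), of k]
  proof (rule card_Un_disjoint)
    have "a \<notin># M" if "M \<in> distinct_parts_in S k" for M
      using that assms(1) by (auto simp: distinct_parts_in_def parts_in_def)
    moreover have "a \<in># M" if "M \<in> (if a \<le> k then add_mset a ` distinct_parts_in S (k - a) else {})" for M
      using that by (auto split: if_splits)
    ultimately show "distinct_parts_in S k \<inter> (if a \<le> k then add_mset a ` distinct_parts_in S (k - a) else {}) = {}"
      by blast
  qed (use assms(2) in \<open>simp_all add: finite_distinct_parts_in\<close>)
  also have "\<dots> = card (distinct_parts_in S k) + (if a \<le> k then card (distinct_parts_in S (k - a)) else 0)"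
    by (simp add: card_image inj_on_def)
  finally show "fps_nth (distinct_gf (insert a S) :: 'a fps) k = fps_nth ((1 + fps_X^a) * distinct_gf S) k"
    by (auto simp: distinct_gf_def distrib_right fps_X_power_mult_nth)
qed

lemma parts_in_empty: "parts_in {} k = (if k = 0 then {{#}} else {})"
  by (auto simp: parts_in_def)

lemma parts_gf_empty: "parts_gf {} = 1"
  by (rule fps_ext) (simp add: parts_gf_def parts_in_empty)

lemma distinct_gf_empty: "distinct_gf {} = 1"
proof (rule fps_ext)
  fix k
  have "distinct_parts_in {} k = parts_in {} k"
    by (auto simp: distinct_parts_in_def parts_in_empty)
  then show "fps_nth (distinct_gf {} :: 'a fps) k = fps_nth 1 k"
    by (simp add: distinct_gf_def parts_in_empty)
qed

lemma prod_mult_parts_gf: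
  "finite S \<Longrightarrow> 0 \<notin> S \<Longrightarrow> (\<Prod>k\<in>S. 1 - fps_X^k) * parts_gf S = 1"
proof (induction S rule: finite_induct)
  case (insert a S)
  have "(\<Prod>k\<in>insert a S. 1 - fps_X^k) * parts_gf (insert a S)
      = (\<Prod>k\<in>S. 1 - fps_X^k) * ((1 - fps_X^a) * parts_gf (insert a S) :: 'a fps)"
    by (subst prod.insert[OF insert.hyps]) (simp only: mult_ac)
  also have "\<dots> = 1"
    using insert by (subst parts_gf_insert) auto
  finally show ?case .
qed (simp add: parts_gf_empty)

lemma distinct_gf_prod:
  "finite S \<Longrightarrow> 0 \<notin> S \<Longrightarrow> distinct_gf S = (\<Prod>k\<in>S. 1 + fps_X^k)"
  by (induction S rule: finite_induct) (simp_all add: distinct_gf_empty distinct_gf_insert)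

text \<open>No part exceeds the total k, so the finite set of parts up to n serves all degrees up to
  n.\<close>

lemma partitions_eq_parts_in:
  assumes "k \<le> n"
  shows "partitions (int k) = parts_in {1..n} k"
proof -
  have "0 \<notin># M \<longleftrightarrow> set_mset M \<subseteq> {1..n}" if "sum_mset M = k" for M
  proof -
    have "x \<le> n" if "x \<in># M" for x
      using that assms \<open>sum_mset M = k\<close> by (metis le_add1 le_trans sum_mset.remove)
    then show ?thesis
      by (auto simp: Suc_le_eq intro: gr0I)
  qed
  then show ?thesis
    by (auto simp only: partitions_def parts_in_def of_nat_eq_iff)
qed

section \<open>The generating functions of p and Q_2\<close>

definition p_gf :: "'a::comm_ring_1 fps" where
  "p_gf = Abs_fps (\<lambda>k. of_nat (p (int k)))"

definition Q2_gf :: "'a::comm_ring_1 fps" where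
  "Q2_gf = Abs_fps (\<lambda>k. of_nat (Q2 k))"

lemma p_gf_upto: "eq_upto n (qminus n 1 * p_gf) 1"
proof -
  have "eq_upto n p_gf (parts_gf {1..n} :: 'a fps)"
    by (simp add: eq_upto_def p_gf_def parts_gf_def p_def partitions_eq_parts_in del: One_nat_def)
  then have "eq_upto n (qminus n 1 * p_gf) (qminus n 1 * parts_gf {1..n} :: 'a fps)"
    by (intro eq_upto_mult) simp_all
  then show ?thesis
    by (simp add: qminus_def prod_mult_parts_gf)
qed

lemma Q2_residue_iff:
  "\<not> [int k = 2] (mod 6) \<and> \<not> [int k = -2] (mod 6) \<longleftrightarrow> odd k \<or> 6 dvd k"
proof -
  have "int k mod 6 = int (k mod 6)"
    by (simp add: zmod_int)
  then have "\<not> [int k = 2] (mod 6) \<and> \<not> [int k = -2] (mod 6) \<longleftrightarrow> k mod 6 \<noteq> 2 \<and> k mod 6 \<noteq> 4"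
    by (simp add: cong_def)
  also have "\<dots> \<longleftrightarrow> odd k \<or> 6 dvd k"
    by presburger
  finally show ?thesis .
qed

lemma Q2_gf_upto: "eq_upto n Q2_gf (qplus_odd n 1 * qplus n 6)"
proof -
  define S where "S = {k\<in>{1..n}. odd k \<or> 6 dvd k}"
  have "{M \<in> partitions (int k). \<forall>x \<in># M. count M x = 1 \<and> \<not> [int x = 2] (mod 6) \<and> \<not> [int x = -2] (mod 6)}
      = distinct_parts_in S k" if "k \<le> n" for k
    unfolding Q2_residue_iff partitions_eq_parts_in[OF that]
    by (auto simp: S_def distinct_parts_in_def parts_in_def)
  then have "eq_upto n Q2_gf (distinct_gf S :: 'a fps)"
    by (simp add: eq_upto_def Q2_gf_def distinct_gf_def Q2_def)
  also have "distinct_gf S = (\<Prod>k\<in>S. 1 + fps_X^k)"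
    by (rule distinct_gf_prod) (auto simp: S_def)
  \<comment> \<open>The index set grows to all 2k - 1 and 6k with 1 \<le> k \<le> n; the added
    indices exceed n, hence their factors are 1 up to degree n.\<close>
  also have "eq_upto n \<dots> (\<Prod>k\<in>(\<lambda>k. 2*k-1) ` {1..n} \<union> (\<lambda>k. 6*k) ` {1..n}. 1 + fps_X^k :: 'a fps)"
  proof (intro eq_upto_sym[OF eq_upto_prod_neutral] eq_upto_one_plus)
    show "S \<subseteq> (\<lambda>k. 2*k-1) ` {1..n} \<union> (\<lambda>k. 6*k) ` {1..n}"
    proof
      fix k assume "k \<in> S"
      then consider j where "k = 2*j+1" "k \<le> n" | j where "k = 6*j" "1 \<le> k" "k \<le> n"
        by (auto simp: S_def elim: oddE)
      then show "k \<in> (\<lambda>k. 2*k-1) ` {1..n} \<union> (\<lambda>k. 6*k) ` {1..n}"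
      proof cases
        case (1 j)
        then have "k = 2*(j+1)-1" "j+1 \<in> {1..n}" by auto
        then show ?thesis by blast
      next
        case (2 j)
        then have "j \<in> {1..n}" by auto
        with 2 show ?thesis by blast
      qed
    qed
  qed (auto simp: S_def)
  also have "\<dots> = (\<Prod>k\<in>(\<lambda>k. 2*k-1) ` {1..n}. 1 + fps_X^k) * (\<Prod>k\<in>(\<lambda>k. 6*k) ` {1..n}. 1 + fps_X^k)"
  proof (rule prod.union_disjoint)
    have "2*i-1 \<noteq> 6*j" if "i \<ge> 1" for i j :: nat
      using that by presburger
    then show "(\<lambda>k. 2*k-1) ` {1..n} \<inter> (\<lambda>k. 6*k) ` {1..n} = {}"
      by auto
  qed auto
  also have "\<dots> = qplus_odd n 1 * qplus n 6"
    by (subst (1 2) prod.reindex) (auto simp: inj_on_def qplus_odd_def qplus_def)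
  finally show ?thesis .
qed

text \<open>The case m > n needs no exception: the coefficient is 0, as is p at a negative
  integer.\<close>

lemma p_gf_mult_fps_X_power_nth: "fps_nth (p_gf * fps_X^m) n = of_nat (p (int n - int m))"
  by (auto simp: p_gf_def fps_X_power_mult_right_nth p_neg of_nat_diff)

section \<open>The two congruences\<close>

lemma qplus_split_1: "eq_upto n (qplus_odd n 1 * qplus n 2) (qplus n 1)"
  using qplus_split[of 1 n, OF zero_less_one, THEN eq_upto_sym] by (simp only: mult_1_right)

lemma qminus_mult_qplus_1: "qminus n 1 * qplus n 1 = qminus n 2"
  using qminus_mult_qplus[of n 1] by (simp only: mult_1_right)

lemma qplus_eq_qminus_char_2:
  assumes "(2 :: 'a::comm_ring_1) = 0"
  shows "qplus n d = (qminus n d :: 'a fps)"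
proof -
  have "(2 :: 'a fps) = 0"
    using assms by (metis fps_const_0_eq_0 fps_numeral_fps_const)
  then have *: "1 + f = 1 - f" for f :: "'a fps"
    by (simp add: add_eq_0_iff2 algebra_simps flip: mult_2)
  show ?thesis
    unfolding qplus_def qminus_def by (subst *) (rule refl)
qed

text \<open>Cubing is additive when 3 = 0, since the mixed terms of (1 + f)^3 are 3(f +
  f^2).\<close>

lemma qplus_cube_char_3:
  assumes "(3 :: 'a::comm_ring_1) = 0"
  shows "qplus n d ^ 3 = (qplus n (3*d) :: 'a fps)"
proof -
  have 3: "(3 :: 'a fps) = 0"
    using assms by (metis fps_const_0_eq_0 fps_numeral_fps_const)
  have cube: "(1 + f)^3 = 1 + f^3" for f :: "'a fps"
  proof -
    have "(1 + f)^3 = 1 + f^3 + 3 * (f + f^2)"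
      by (simp add: power3_eq_cube power2_eq_square algebra_simps)
    then show ?thesis by (simp add: 3)
  qed
  show ?thesis
    by (simp add: qplus_def cube prod_power_distrib mult_ac flip: power_mult)
qed

text \<open>Both sides are multiplied by \<open>qminus n 1\<close>, the inverse of
  \<open>p_gf\<close> up to degree n. It then remains to see that it also inverts
  \<open>qplus_odd n 1\<close>.\<close>

lemma Q2_gf_char_2:
  assumes "(2 :: 'a::comm_ring_1) = 0"
  shows "eq_upto n (Q2_gf :: 'a fps) (p_gf * qminus n 6)"
proof (rule eq_upto_cancel)
  have "eq_upto n (qminus n 1 * qplus_odd n 1) (1 :: 'a fps)"
  proof (rule eq_upto_cancel)
    \<comment> \<open>\<open>qplus n 2\<close> completes the odd factors to
      \<open>qplus n 1\<close>. As signs do not matter, the resulting square of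
      \<open>qplus n 1\<close> is E(q)(1+q)(1+q^2)... = E(q^2), which is \<open>qplus n 2\<close>
      again.\<close>
    have "qplus n 2 * (qminus n 1 * qplus_odd n 1) = qplus n 1 * (qplus_odd n 1 * qplus n 2 :: 'a fps)"
      by (simp only: mult_ac qplus_eq_qminus_char_2[OF assms, of n 1])
    also have "eq_upto n \<dots> (qplus n 1 * qplus n 1)"
      by (intro eq_upto_mult qplus_split_1) auto
    also have "qplus n 1 * qplus n 1 = (qplus n 2 * 1 :: 'a fps)"
      using qminus_mult_qplus_1[of n, where ?'a = 'a] by (simp add: qplus_eq_qminus_char_2[OF assms])
    finally show "eq_upto n (qplus n 2 * (qminus n 1 * qplus_odd n 1)) (qplus n 2 * 1 :: 'a fps)" .
  qed (simp add: qplus_nth_0)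
  note odd = this
  have "eq_upto n (qminus n 1 * Q2_gf) (qminus n 1 * (qplus_odd n 1 * qplus n 6) :: 'a fps)"
    by (intro eq_upto_mult Q2_gf_upto) simp
  also have "\<dots> = (qminus n 1 * qplus_odd n 1) * qminus n 6"
    by (simp add: mult.assoc qplus_eq_qminus_char_2[OF assms])
  also have "eq_upto n \<dots> (1 * qminus n 6)"
    by (intro eq_upto_mult odd) simp
  also have "eq_upto n \<dots> (qminus n 1 * p_gf * qminus n 6)"
    by (intro eq_upto_mult eq_upto_sym[OF p_gf_upto]) simp
  finally show "eq_upto n (qminus n 1 * Q2_gf) (qminus n 1 * (p_gf * qminus n 6) :: 'a fps)"
    by (simp add: mult.assoc)
qed (simp add: qminus_nth_0)

lemma Q2_gf_char_3:
  assumes "(3 :: 'a::comm_ring_1) = 0"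
  shows "eq_upto n (Q2_gf :: 'a fps) (p_gf * (\<Sum>j\<le>2*n. fps_X^(2*(\<Sum>{..j}))))"
proof (rule eq_upto_cancel)
  define T :: "'a fps" where "T = (\<Sum>j\<le>2*n. fps_X^(2*(\<Sum>{..j})))"
  have "eq_upto n (qminus n 1 * Q2_gf) (qminus n 1 * (qplus_odd n 1 * qplus n 6) :: 'a fps)"
    by (intro eq_upto_mult Q2_gf_upto) simp
  \<comment> \<open>Of the three copies of \<open>qplus n 2\<close> in \<open>qplus n 6\<close>, one
    completes the odd factors, one turns E(q^2) into E(q^4), and the last cancels
    \<open>qminus_odd n 2\<close> from Gauss's identity.\<close>
  also have "\<dots> = qminus n 1 * (qplus_odd n 1 * qplus n 2) * qplus n 2 * qplus n 2"
    using qplus_cube_char_3[OF assms, of n 2] by (simp add: power3_eq_cube mult_ac)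
  also have "eq_upto n \<dots> (qminus n 1 * qplus n 1 * qplus n 2 * qplus n 2)"
    by (intro eq_upto_mult qplus_split_1) auto
  also have "\<dots> = qminus n (2*2) * qplus n 2"
    using qminus_mult_qplus_1[of n, where ?'a = 'a] qminus_mult_qplus[of n 2, where ?'a = 'a] by simp
  also have "eq_upto n \<dots> (qminus_odd n 2 * T * qplus n 2)"
    unfolding T_def by (intro eq_upto_mult triangular_upto) auto
  also have "\<dots> = (qminus_odd n 2 * qplus n 2) * T"
    by (simp add: ac_simps)
  also have "eq_upto n \<dots> (1 * T)"
    by (intro eq_upto_mult Euler_odd_distinct) auto
  also have "eq_upto n \<dots> (qminus n 1 * p_gf * T)"
    by (intro eq_upto_mult eq_upto_sym[OF p_gf_upto]) simp
  finally show "eq_upto n (qminus n 1 * Q2_gf) (qminus n 1 * (p_gf * (\<Sum>j\<le>2*n. fps_X^(2*(\<Sum>{..j})))) :: 'a fps)"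
    by (simp add: mult.assoc T_def)
qed (simp add: qminus_nth_0)

section \<open>From coefficients to the sums over j\<close>

lemma sum_int_symmetric:
  fixes f :: "int \<Rightarrow> 'a::comm_monoid_add"
  shows "sum f {- int n..int n} = f 0 + (\<Sum>m=1..n. f (int m) + f (- int m))"
proof (induction n)
  case (Suc n)
  have "{- int (Suc n)..int (Suc n)} = insert (int (Suc n)) (insert (- int (Suc n)) {- int n..int n})"
    by auto
  then show ?case
    using Suc by (simp add: ac_simps)
qed simp

lemma double_gauss_sum: "2 * \<Sum>{..m} = m * (m + 1)" for m :: nat
  by (induction m) simp_all

text \<open>Six times the pentagonal numbers m(3m-1)/2 and m(3m+1)/2 are the values of 3j(3j-1) at j
  = m and j = -m.\<close>

lemma six_pentagonal:
  assumes "m \<ge> 1"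
  shows "int (6 * (m * (m-1) + \<Sum>{..m})) = 3 * int m * (3 * int m - 1)"
    and "int (6 * (m * m + \<Sum>{..m})) = 3 * (- int m) * (3 * (- int m) - 1)"
proof -
  obtain i where m: "m = Suc i"
    using assms by (cases m) auto
  have "6 * (m * (m-1) + \<Sum>{..m}) = 6 * (m * (m-1)) + 3 * (m * (m + 1))"
    "6 * (m * m + \<Sum>{..m}) = 6 * (m * m) + 3 * (m * (m + 1))"
    unfolding double_gauss_sum[of m, symmetric] by (simp_all only: distrib_left mult.assoc[symmetric])
  then show "int (6 * (m * (m-1) + \<Sum>{..m})) = 3 * int m * (3 * int m - 1)"
    "int (6 * (m * m + \<Sum>{..m})) = 3 * (- int m) * (3 * (- int m) - 1)"
    by (simp_all only: m diff_Suc_1) (simp_all add: algebra_simps)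
qed

text \<open>The signs (-1)^m of the pentagonal series are left out, in view of its use modulo
  2.\<close>

lemma p_gf_pentagonal_nth:
  fixes n :: nat
  defines "f \<equiv> \<lambda>j :: int. p (int n - 3 * j * (3 * j - 1))"
  shows "fps_nth (p_gf * (1 + (\<Sum>m=1..n. fps_X^(6*(m*(m-1) + (\<Sum>{..m}))) + fps_X^(6*(m*m + (\<Sum>{..m})))))) n
    = (of_nat (f 0 + (\<Sum>m=1..n. f (int m) + f (- int m))) :: 'a::comm_ring_1)"
proof -
  have "p_gf * (1 + (\<Sum>m=1..n. fps_X^(6*(m*(m-1) + (\<Sum>{..m}))) + fps_X^(6*(m*m + (\<Sum>{..m})))))
    = (p_gf * fps_X^0 + (\<Sum>m=1..n. p_gf * fps_X^(6*(m*(m-1) + (\<Sum>{..m}))) + p_gf * fps_X^(6*(m*m + (\<Sum>{..m})))) :: 'a fps)"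
    by (simp only: distrib_left sum_distrib_left power_0)
  also have "fps_nth \<dots> n = of_nat (f 0) + (\<Sum>m=1..n. of_nat (f (int m)) + of_nat (f (- int m)))"
    unfolding fps_add_nth fps_sum_nth p_gf_mult_fps_X_power_nth f_def
    by (intro arg_cong2[where f = "(+)"] sum.cong refl) (simp_all only: six_pentagonal atLeastAtMost_iff, simp)
  finally show ?thesis
    by (simp only: of_nat_add of_nat_sum)
qed

theorem corollary1p13:
  fixes n :: nat
  shows "[Sum_any (\<lambda>j :: int. p (int n - 3 * j * (3 * j - 1))) = Q2 n] (mod 2)
       \<and> [Sum_any (\<lambda>j :: nat. p (int n - int j * (int j + 1))) = Q2 n] (mod 3)"
proof
  define f where "f = (\<lambda>j :: int. p (int n - 3 * j * (3 * j - 1)))"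
  have supp: "{j. f j \<noteq> 0} \<subseteq> {- int n..int n}"
  proof
    fix j assume "j \<in> {j. f j \<noteq> 0}"
    then have "3 * j * (3 * j - 1) \<le> int n"
      using p_neg[of "int n - 3 * j * (3 * j - 1)"] by (force simp: f_def)
    moreover have "\<bar>j\<bar> \<le> 3 * j * (3 * j - 1)"
    proof (cases "j \<ge> 1")
      case True
      then have "j * 1 \<le> j * (3 * (3 * j - 1))"
        by (intro mult_left_mono) auto
      with True show ?thesis by (simp add: algebra_simps)
    next
      case False
      then have "(-j) * 1 \<le> (-j) * (3 * (1 - 3 * j))"
        by (intro mult_left_mono) auto
      with False show ?thesis by (simp add: algebra_simps)
    qed
    ultimately show "j \<in> {- int n..int n}" by auto
  qed
  have minus_one: "(-1 :: 2 fps) = 1"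
    by (rule fps_ext) simp
  \<comment> \<open>The numeral type \<open>2\<close> is the ring of integers modulo 2, where
    equality of \<open>of_nat\<close> values is congruence; \<open>3\<close> plays the same role
    below.\<close>
  have "eq_upto n (Q2_gf :: 2 fps) (p_gf * qminus n 6)"
    by (rule Q2_gf_char_2) simp
  also have "eq_upto n \<dots>
      (p_gf * (1 + (\<Sum>m=1..n. fps_X^(6*(m*(m-1) + (\<Sum>{..m}))) + fps_X^(6*(m*m + (\<Sum>{..m}))))))"
    using pentagonal_upto[where ?'a = 2 and d = 6 and n = n, OF zero_less_numeral]
    by (intro eq_upto_mult eq_upto_refl) (simp only: minus_one power_one mult_1_left)
  finally have "fps_nth (Q2_gf :: 2 fps) n = of_nat (f 0 + (\<Sum>m=1..n. f (int m) + f (- int m)))"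
    unfolding eq_upto_def f_def p_gf_pentagonal_nth[symmetric] by simp
  also have "f 0 + (\<Sum>m=1..n. f (int m) + f (- int m)) = Sum_any f"
    by (simp only: Sum_any.expand_superset[OF _ supp] finite_atLeastAtMost_int sum_int_symmetric)
  finally have "of_nat (Sum_any f) = (of_nat (Q2 n) :: 2)"
    by (simp add: Q2_gf_def)
  then show "[Sum_any (\<lambda>j :: int. p (int n - 3 * j * (3 * j - 1))) = Q2 n] (mod 2)"
    by (simp only: of_nat_eq_iff_cong_CHAR f_def) simp

  define g where "g = (\<lambda>j :: nat. p (int n - int j * (int j + 1)))"
  \<comment> \<open>The bound 2n is generous; it matches the range of the triangular sum in
    \<open>Q2_gf_char_3\<close>.\<close>
  have "{j. g j \<noteq> 0} \<subseteq> {..2*n}"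
  proof
    fix j assume "j \<in> {j. g j \<noteq> 0}"
    then have "int j * (int j + 1) \<le> int n"
      using p_neg[of "int n - int j * (int j + 1)"] by (force simp: g_def)
    moreover have "int j * 1 \<le> int j * (int j + 1)"
      by (intro mult_left_mono) auto
    ultimately show "j \<in> {..2*n}" by simp
  qed
  then have g: "Sum_any g = (\<Sum>j\<le>2*n. g j)"
    by (intro Sum_any.expand_superset) auto
  have "eq_upto n (Q2_gf :: 3 fps) (p_gf * (\<Sum>j\<le>2*n. fps_X^(2*(\<Sum>{..j}))))"
    by (rule Q2_gf_char_3) simp
  then have "fps_nth (Q2_gf :: 3 fps) n = fps_nth (\<Sum>j\<le>2*n. p_gf * fps_X^(j*(j+1))) n"
    unfolding eq_upto_def by (simp only: double_gauss_sum) (simp only: sum_distrib_left order_refl)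
  also have "\<dots> = (\<Sum>j\<le>2*n. of_nat (g j))"
    unfolding fps_sum_nth p_gf_mult_fps_X_power_nth g_def by (simp add: algebra_simps)
  finally have "of_nat (Sum_any g) = (of_nat (Q2 n) :: 3)"
    by (simp add: Q2_gf_def g)
  then show "[Sum_any (\<lambda>j :: nat. p (int n - int j * (int j + 1))) = Q2 n] (mod 3)"
    by (simp only: of_nat_eq_iff_cong_CHAR g_def) simp
qed

end
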